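(* Let $f\in\mathcal{B}$ with power series $f(z)=\sum_{n=0}^{\infty} a_n z^n$ in $\mathbb{D}$. Then for every $r\in[0,1)$, $$\sum_{n=0}^{\infty}|a_n|r^n \leq \frac{1}{1-r}\left(1-r\|f\|_r^2\right).$$ Equality is attained for the constant function $f(z)=1$, $z\in\mathbb{D}$.
   Context: $\mathbb{D}=\{z\in\mathbb{C}: |z|<1\}$ is the open unit disk, and $\mathcal{B}$ is the class of all analytic functions $f$ in $\mathbb{D}$ with $|f(z)|\leq 1$ for all $z\in\mathbb{D}$. For $f(z)=\sum_{n=0}^{\infty}a_nz^n$ analytic in $\mathbb{D}$ and $r\in[0,1)$, the notation $\|f\|_r^2$ means $\|f\|_r^2=\sum_{n=0}^{\infty}|a_n|^2r^{2n}$. *)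

theory Defs
  imports "HOL-Complex_Analysis.Complex_Analysis"
begin

definition unit_disk :: "complex set" where
  "unit_disk = {z. cmod z < 1}"

definition class_B :: "(complex \<Rightarrow> complex) set" where
  "class_B = {f. f analytic_on unit_disk \<and> (\<forall>z\<in>unit_disk. cmod (f z) \<le> 1)}"

definition power_series_on_disk :: "(nat \<Rightarrow> complex) \<Rightarrow> (complex \<Rightarrow> complex) \<Rightarrow> bool" where
  "power_series_on_disk a f \<longleftrightarrow> (\<forall>z\<in>unit_disk. (\<lambda>n. a n * z ^ n) sums f z)"

(* The squared norm is a function of f alone, through its Taylor coefficients at 0.
   As an infinite sum it is meaningful only when the series converges; for r < 1 and f analytic
   in the unit disk it always does. The term n = 0 is |a_0|^2 also for r = 0, as 0 ^ 0 = 1. *)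
definition disk_norm_sq :: "(complex \<Rightarrow> complex) \<Rightarrow> real \<Rightarrow> real" where
  "disk_norm_sq f r = (\<Sum>n. (cmod (fps_nth (fps_expansion f 0) n))\<^sup>2 * r ^ (2 * n))"

end

theory Submission
  imports Defs
begin

text \<open>
  The inequality follows by summing Carlson's bound
  $|a_n| \le 1 - \sum_{2k+1 \le n} |a_k|^2$ against $r^n$, since the terms with $2k+1 \le n$
  contribute $\sum_k |a_k|^2 r^{2k+1}/(1-r) = r \|f\|_r^2/(1-r)$.
  For Carlson's bound let $m \le (n+1)/2$ and $s = \sum_{k<m} |a_k|^2$, let $\beta$ be the phase
  of $a_n$, and put $h(z) = 1 + \beta \sum_{k<m} \overline{a_k} z^{n-k}$. Multiplication by $f$ does
  not increase the $L^2$ norm on circles, and $fh$ has coefficients $a_k$ for $k<m$ and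
  $a_n + \beta s$ for $k=n$. Hence $s + (|a_n| + s)^2 \le \|h\|^2 = 1 + s$.
\<close>

section \<open>Fourier analysis of power series on circles\<close>

text \<open>On the circle the conjugate of c is \<rho>^2 / c, so this is Cauchy's formula for the
  k-th derivative at 0; the factor c' = 2 pi i c cancels one power of c in the denominator.\<close>

lemma circlepath_fps_nth:
  assumes hol: "g holomorphic_on ball 0 1" and G: "g has_fps_expansion G"
    and \<rho>: "0 < \<rho>" "\<rho> < 1"
  shows "((\<lambda>t. g (circlepath 0 \<rho> t) * cnj (circlepath 0 \<rho> t) ^ k)
            has_integral fps_nth G k * of_real (\<rho> ^ (2 * k))) {0..1}"
proof -
  let ?c = "circlepath 0 \<rho>"
  have c: "?c t \<noteq> 0" "cnj (?c t) = of_real (\<rho>\<^sup>2) / ?c t" for t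
  proof -
    have n: "cmod (?c t) = \<rho>"
      using \<rho> by (simp add: circlepath norm_mult)
    show "?c t \<noteq> 0"
      using n \<rho> by force
    then show "cnj (?c t) = of_real (\<rho>\<^sup>2) / ?c t"
      using complex_norm_square[of "?c t"] n by (simp add: field_simps)
  qed
  have ck: "cnj (?c t) ^ k = of_real (\<rho> ^ (2 * k)) / ?c t ^ k" for t
    by (simp add: c(2) power_divide power_mult)
  have c': "vector_derivative ?c (at t within {0..1}) = 2 * pi * \<i> * ?c t" if "t \<in> {0..1}" for t
    using that by (simp add: vector_derivative_circlepath01) (simp add: circlepath)
  have hol': "g holomorphic_on cball 0 \<rho>"
    using \<rho> by (intro holomorphic_on_subset[OF hol]) auto
  have "((\<lambda>u. g u / (u - 0) ^ Suc k) has_contour_integral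
          (2 * pi * \<i>) / fact k * (deriv ^^ k) g 0) ?c"
    using \<rho> by (intro Cauchy_has_contour_integral_higher_derivative_circlepath
        holomorphic_on_imp_continuous_on hol' holomorphic_on_subset[OF hol']) auto
  then have "((\<lambda>t. g (?c t) / ?c t ^ Suc k * (2 * pi * \<i> * ?c t))
      has_integral 2 * pi * \<i> * fps_nth G k) {0..1}"
    unfolding has_contour_integral_def fps_nth_fps_expansion[OF G]
    by (rule has_integral_eq_rhs[OF has_integral_eq, rotated]) (auto simp: c')
  from has_integral_mult_right[OF this, of "of_real (\<rho> ^ (2 * k)) / (2 * pi * \<i>)"]
  show ?thesis
    by (rule has_integral_eq_rhs[OF has_integral_eq, rotated])
      (use c(1) in \<open>auto simp: ck field_simps\<close>)
qed

lemma circlepath_inner_polynomial: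
  assumes "g holomorphic_on ball 0 1" "g has_fps_expansion G" "0 < \<rho>" "\<rho> < 1"
  shows "((\<lambda>t. g (circlepath 0 \<rho> t) * cnj (\<Sum>k\<le>n. q k * circlepath 0 \<rho> t ^ k))
            has_integral (\<Sum>k\<le>n. fps_nth G k * cnj (q k) * of_real (\<rho> ^ (2 * k)))) {0..1}"
proof -
  have "((\<lambda>t. \<Sum>k\<le>n. cnj (q k) * (g (circlepath 0 \<rho> t) * cnj (circlepath 0 \<rho> t) ^ k))
          has_integral (\<Sum>k\<le>n. cnj (q k) * (fps_nth G k * of_real (\<rho> ^ (2 * k))))) {0..1}"
    by (intro has_integral_sum has_integral_mult_right circlepath_fps_nth assms) auto
  then show ?thesis
    by (simp add: sum_distrib_left mult_ac)
qed

lemma circlepath_Parseval_polynomial: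
  assumes "0 < \<rho>" "\<rho> < 1"
  shows "((\<lambda>t. (cmod (\<Sum>k\<le>n. q k * circlepath 0 \<rho> t ^ k))\<^sup>2)
            has_integral (\<Sum>k\<le>n. (cmod (q k))\<^sup>2 * \<rho> ^ (2 * k))) {0..1}"
proof -
  have "(\<lambda>z. \<Sum>k\<le>n. q k * z ^ k) has_fps_expansion (\<Sum>k\<le>n. fps_const (q k) * fps_X ^ k)"
    by (intro fps_expansion_intros)
  moreover have "(\<lambda>z. \<Sum>k\<le>n. q k * z ^ k) holomorphic_on ball 0 1"
    by (intro holomorphic_intros)
  ultimately have "((\<lambda>t. (\<Sum>k\<le>n. q k * circlepath 0 \<rho> t ^ k) * cnj (\<Sum>k\<le>n. q k * circlepath 0 \<rho> t ^ k))
      has_integral (\<Sum>k\<le>n. fps_nth (\<Sum>k\<le>n. fps_const (q k) * fps_X ^ k) k * cnj (q k) * of_real (\<rho> ^ (2 * k)))) {0..1}"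
    using assms by (intro circlepath_inner_polynomial)
  also have "(\<Sum>k\<le>n. fps_nth (\<Sum>k\<le>n. fps_const (q k) * fps_X ^ k) k * cnj (q k) * of_real (\<rho> ^ (2 * k)))
      = of_real (\<Sum>k\<le>n. (cmod (q k))\<^sup>2 * \<rho> ^ (2 * k))"
    by (simp add: fps_sum_nth if_distrib complex_norm_square[symmetric] cong: if_cong)
  finally have "((\<lambda>t. complex_of_real ((cmod (\<Sum>k\<le>n. q k * circlepath 0 \<rho> t ^ k))\<^sup>2))
      has_integral of_real (\<Sum>k\<le>n. (cmod (q k))\<^sup>2 * \<rho> ^ (2 * k))) {0..1}"
    by (simp only: complex_norm_square)
  from has_integral_Re[OF this] show ?thesis
    by simp
qed

text \<open>With p the Taylor polynomial of degree n, the pairing of g with p and the squared norm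
  of p both equal the left-hand sum S. Hence the integral of |g - p|^2, which is nonnegative, equals
  I - 2S + S.\<close>

lemma circlepath_Bessel:
  assumes hol: "g holomorphic_on ball 0 1" and G: "g has_fps_expansion G"
    and \<rho>: "0 < \<rho>" "\<rho> < 1"
    and I: "((\<lambda>t. (cmod (g (circlepath 0 \<rho> t)))\<^sup>2) has_integral I) {0..1}"
  shows "(\<Sum>k\<le>n. (cmod (fps_nth G k))\<^sup>2 * \<rho> ^ (2 * k)) \<le> I"
proof -
  let ?c = "circlepath 0 \<rho>"
  define p where "p z = (\<Sum>k\<le>n. fps_nth G k * z ^ k)" for z
  define S where "S = (\<Sum>k\<le>n. (cmod (fps_nth G k))\<^sup>2 * \<rho> ^ (2 * k))"
  have "((\<lambda>t. g (?c t) * cnj (p (?c t))) has_integral of_real S) {0..1}"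
    using circlepath_inner_polynomial[OF hol G \<rho>, where q = "fps_nth G" and n = n]
    by (simp add: p_def S_def complex_norm_square[symmetric])
  from has_integral_Re[OF this]
  have "((\<lambda>t. Re (g (?c t) * cnj (p (?c t)))) has_integral S) {0..1}"
    by simp
  moreover have "((\<lambda>t. (cmod (p (?c t)))\<^sup>2) has_integral S) {0..1}"
    using circlepath_Parseval_polynomial[OF \<rho>] by (simp add: p_def S_def)
  ultimately have "((\<lambda>t. (cmod (g (?c t)))\<^sup>2 - 2 * Re (g (?c t) * cnj (p (?c t))) + (cmod (p (?c t)))\<^sup>2)
      has_integral I - 2 * S + S) {0..1}"
    by (intro has_integral_add has_integral_diff has_integral_mult_right I)
  moreover have "(cmod (u - v))\<^sup>2 = (cmod u)\<^sup>2 - 2 * Re (u * cnj v) + (cmod v)\<^sup>2" for u v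
    by (simp add: cmod_power2 power2_diff algebra_simps)
  ultimately have "((\<lambda>t. (cmod (g (?c t) - p (?c t)))\<^sup>2) has_integral I - S) {0..1}"
    by simp
  then have "0 \<le> I - S"
    by (rule has_integral_nonneg) simp
  then show ?thesis
    by (simp add: S_def)
qed

section \<open>Carlson's coefficient bound\<close>

text \<open>Bessel for the product, |f h| \<le> |h| pointwise, and Parseval for h give the bound on
  each circle of radius \<rho> < 1. As f need not extend to the unit circle, the weights on the left
  are removed only by a limit.\<close>

lemma mult_polynomial_coeff_bound:
  assumes hol: "f holomorphic_on ball 0 1" and F: "f has_fps_expansion F"
    and bound: "\<And>z. z \<in> ball 0 1 \<Longrightarrow> cmod (f z) \<le> 1"
  shows "(\<Sum>k\<le>n. (cmod (fps_nth (F * (\<Sum>k\<le>n. fps_const (q k) * fps_X ^ k)) k))\<^sup>2)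
           \<le> (\<Sum>k\<le>n. (cmod (q k))\<^sup>2)" (is "?L \<le> ?R")
proof -
  define h where "h z = (\<Sum>k\<le>n. q k * z ^ k)" for z
  define H where "H = (\<Sum>k\<le>n. fps_const (q k) * fps_X ^ k)"
  have fh: "(\<lambda>z. f z * h z) has_fps_expansion F * H"
    unfolding h_def H_def by (intro fps_expansion_intros F)
  have fh_hol: "(\<lambda>z. f z * h z) holomorphic_on ball 0 1"
    unfolding h_def by (intro holomorphic_intros hol)
  have *: "(\<Sum>k\<le>n. (cmod (fps_nth (F * H) k))\<^sup>2 * \<rho> ^ (2 * k)) \<le> ?R" if \<rho>: "0 < \<rho>" "\<rho> < 1" for \<rho>
  proof -
    let ?c = "circlepath 0 \<rho>"
    have c: "?c t \<in> ball 0 1" for t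
      using \<rho> by (simp add: circlepath norm_mult)
    have "continuous_on {0..1} (\<lambda>t. f (?c t) * h (?c t))"
      by (rule continuous_on_compose2[OF holomorphic_on_imp_continuous_on[OF fh_hol]])
        (use c in \<open>auto simp: circlepath intro!: continuous_intros\<close>)
    then have "(\<lambda>t. (cmod (f (?c t) * h (?c t)))\<^sup>2) integrable_on {0..1}"
      by (intro integrable_continuous_interval continuous_on_power continuous_on_norm)
    then obtain I where I: "((\<lambda>t. (cmod (f (?c t) * h (?c t)))\<^sup>2) has_integral I) {0..1}"
      by blast
    have "(\<Sum>k\<le>n. (cmod (fps_nth (F * H) k))\<^sup>2 * \<rho> ^ (2 * k)) \<le> I"
      by (rule circlepath_Bessel[OF fh_hol fh \<rho> I])
    also have "I \<le> (\<Sum>k\<le>n. (cmod (q k))\<^sup>2 * \<rho> ^ (2 * k))"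
    proof (rule has_integral_le[OF I circlepath_Parseval_polynomial[OF \<rho>]])
      show "(cmod (f (?c t) * h (?c t)))\<^sup>2 \<le> (cmod (\<Sum>k\<le>n. q k * ?c t ^ k))\<^sup>2" for t
        using bound[OF c] by (auto simp: h_def norm_mult intro!: power_mono mult_left_le_one_le)
    qed
    also have "\<dots> \<le> ?R"
      using \<rho> by (intro sum_mono mult_left_le power_le_one) auto
    finally show ?thesis .
  qed
  \<comment> \<open>A finite sum is continuous in \<rho>, so the bound survives \<rho> -> 1.\<close>
  have "((\<lambda>\<rho>. \<Sum>k\<le>n. (cmod (fps_nth (F * H) k))\<^sup>2 * \<rho> ^ (2 * k)) \<longlongrightarrow>
          (\<Sum>k\<le>n. (cmod (fps_nth (F * H) k))\<^sup>2 * 1 ^ (2 * k))) (at_left 1)"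
    by (intro tendsto_intros)
  moreover have "eventually (\<lambda>\<rho>. (\<Sum>k\<le>n. (cmod (fps_nth (F * H) k))\<^sup>2 * \<rho> ^ (2 * k)) \<le> ?R) (at_left 1)"
    using eventually_at_left_real[of 0 "1::real"] by (rule eventually_mono) (auto intro: *)
  ultimately show ?thesis
    using tendsto_upperbound by (fastforce simp: H_def)
qed

lemma Carlson_coeff_bound:
  assumes hol: "f holomorphic_on ball 0 1" and F: "f has_fps_expansion F"
    and bound: "\<And>z. z \<in> ball 0 1 \<Longrightarrow> cmod (f z) \<le> 1"
    and m: "2 * m \<le> Suc n"
  shows "cmod (fps_nth F n) + (\<Sum>k<m. (cmod (fps_nth F k))\<^sup>2) \<le> 1"
proof -
  define s where "s = (\<Sum>k<m. (cmod (fps_nth F k))\<^sup>2)"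
  \<comment> \<open>The value 1 replaces \<open>sgn 0 = 0\<close>, so that \<beta> is unimodular in
    every case.\<close>
  define \<beta> where "\<beta> = (if fps_nth F n = 0 then 1 else sgn (fps_nth F n))"
  have \<beta>: "cmod \<beta> = 1" "fps_nth F n = cmod (fps_nth F n) * \<beta>"
    by (auto simp: \<beta>_def sgn_eq norm_divide)
  \<comment> \<open>the coefficients of $h$; $2m \le n+1$ keeps its higher terms in degrees at least $m$\<close>
  define q where "q k = (if k = 0 then 1 else if n < k + m then \<beta> * cnj (fps_nth F (n - k)) else 0)" for k
  define H where "H = (\<Sum>k\<le>n. fps_const (q k) * fps_X ^ k)"
  have H: "fps_nth H k = (if k \<le> n then q k else 0)" for k
    by (auto simp: H_def fps_sum_nth if_distrib cong: if_cong)
  have mn: "m \<le> n"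
    using m by linarith
  \<comment> \<open>For i < k < m the index k - i satisfies k - i + m \<le> 2m - 1 \<le> n, where q
    vanishes; only q 0 = 1 contributes.\<close>
  have FH_low: "fps_nth (F * H) k = fps_nth F k" if "k < m" for k
  proof -
    have "fps_nth (F * H) k = (\<Sum>i=0..k. if i = k then fps_nth F k else 0)"
      unfolding fps_mult_nth H using that m by (intro sum.cong) (auto simp: q_def)
    then show ?thesis by simp
  qed
  have sq: "s = (\<Sum>i\<le>n. if i < m then (cmod (fps_nth F i))\<^sup>2 else 0)"
  proof -
    have "{..n} \<inter> {i. i < m} = {..<m}"
      using mn by auto
    then show ?thesis
      by (simp add: s_def sum.If_cases)
  qed
  \<comment> \<open>The term i = n meets q 0 = 1; a term i < m meets q (n - i), which is \<beta>
    times the conjugate of the same coefficient.\<close>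
  have FH_n: "fps_nth (F * H) n = fps_nth F n + \<beta> * s"
  proof -
    have "fps_nth (F * H) n = (\<Sum>i\<le>n. (if i = n then fps_nth F n else 0)
             + \<beta> * of_real (if i < m then (cmod (fps_nth F i))\<^sup>2 else 0))"
      unfolding fps_mult_nth H atLeast0AtMost using mn
      by (intro sum.cong) (auto simp: q_def complex_norm_square[symmetric])
    then show ?thesis
      by (simp add: sum.distrib sq sum_distrib_left)
  qed
  have "(cmod (fps_nth F n) + s)\<^sup>2 + s = (cmod (fps_nth (F * H) n))\<^sup>2 + (\<Sum>k<m. (cmod (fps_nth (F * H) k))\<^sup>2)"
  proof -
    \<comment> \<open>Both summands have phase \<beta>, so their moduli add.\<close>
    have "fps_nth F n + \<beta> * s = of_real (cmod (fps_nth F n) + s) * \<beta>"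
      by (metis \<beta>(2) distrib_right mult.commute of_real_add)
    moreover have "0 \<le> s"
      by (simp add: s_def sum_nonneg)
    ultimately have "cmod (fps_nth (F * H) n) = cmod (fps_nth F n) + s"
      by (simp only: FH_n norm_mult \<beta>(1) norm_of_real) simp
    then show ?thesis
      by (simp add: FH_low s_def)
  qed
  also have "\<dots> = (\<Sum>k\<in>insert n {..<m}. (cmod (fps_nth (F * H) k))\<^sup>2)"
    using mn by simp
  also have "\<dots> \<le> (\<Sum>k\<le>n. (cmod (fps_nth (F * H) k))\<^sup>2)"
    using mn by (intro sum_mono2) auto
  also have "\<dots> \<le> (\<Sum>k\<le>n. (cmod (q k))\<^sup>2)"
    unfolding H_def by (rule mult_polynomial_coeff_bound[OF hol F bound])
  also have "\<dots> = (\<Sum>k\<le>n. (cmod (q (n - k)))\<^sup>2)"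
    using sum.nat_diff_reindex[of "\<lambda>k. (cmod (q k))\<^sup>2" "Suc n"] by (simp add: lessThan_Suc_atMost)
  also have "\<dots> = (\<Sum>k\<le>n. (if k = n then 1 else 0) + (if k < m then (cmod (fps_nth F k))\<^sup>2 else 0))"
    using mn \<beta>(1) by (intro sum.cong) (auto simp: q_def norm_mult)
  also have "\<dots> = 1 + s"
    by (simp add: sum.distrib sq)
  \<comment> \<open>The summand s on both sides cancels.\<close>
  finally have "(cmod (fps_nth F n) + s)\<^sup>2 \<le> 1\<^sup>2"
    by simp
  then show ?thesis
    unfolding s_def[symmetric] by (rule power2_le_imp_le) simp
qed

section \<open>Summation of Carlson's bound\<close>

text \<open>The case m = 0 gives b n \<le> 1, hence convergence by comparison with geometric series.
  The inequality uses the largest admissible m, which is \<open>Suc n div 2\<close>.\<close>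

lemma suminf_bound_of_Carlson:
  fixes b :: "nat \<Rightarrow> real"
  assumes b: "\<And>n. 0 \<le> b n" and r: "0 \<le> r" "r < 1"
    and Carlson: "\<And>m n. 2 * m \<le> Suc n \<Longrightarrow> b n + (\<Sum>k<m. (b k)\<^sup>2) \<le> 1"
  shows "summable (\<lambda>n. b n * r ^ n)" "summable (\<lambda>n. (b n)\<^sup>2 * r ^ (2 * n))"
    and "(\<Sum>n. b n * r ^ n) \<le> 1 / (1 - r) * (1 - r * (\<Sum>n. (b n)\<^sup>2 * r ^ (2 * n)))"
proof -
  have b1: "b n \<le> 1" for n
    using Carlson[of 0 n] by simp
  have geo: "summable (\<lambda>n. r ^ n)"
    using r by (simp add: summable_geometric)
  show sb: "summable (\<lambda>n. b n * r ^ n)"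
    using r b b1 by (intro summable_comparison_test'[OF geo]) (auto intro!: mult_left_le_one_le)
  have geo2: "summable (\<lambda>n. (r\<^sup>2) ^ n)"
    using r by (simp add: summable_geometric abs_square_less_1)
  show sb2: "summable (\<lambda>n. (b n)\<^sup>2 * r ^ (2 * n))"
    using b b1 by (intro summable_comparison_test'[OF geo2])
      (auto simp: power_mult power_le_one intro!: mult_left_le_one_le)
  define N where "N = (\<Sum>n. (b n)\<^sup>2 * r ^ (2 * n))"
  \<comment> \<open>the coefficients of $z \sum_k b_k^2 z^{2k}$, so that dividing by $1-z$ yields the sums in Carlson's bound\<close>
  define e where "e j = (if even j then 0 else (b ((j - 1) div 2))\<^sup>2)" for j
  have "(\<lambda>n. r * ((b n)\<^sup>2 * r ^ (2 * n))) sums (r * N)"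
    unfolding N_def by (intro sums_mult summable_sums sb2)
  \<comment> \<open>\<open>sums_if'\<close> moves the k-th term to index 2k + 1 and fills the even
    indices with zeros, matching r * r^(2k) = r^(2k+1).\<close>
  from sums_if'[OF this] have e: "(\<lambda>j. e j * r ^ j) sums (r * N)"
    by (rule sums_cong[THEN iffD1, rotated])
      (auto simp: e_def elim!: oddE)
  have e_sum: "(\<Sum>j\<le>n. e j) = (\<Sum>k<Suc n div 2. (b k)\<^sup>2)" for n
    by (induction n) (auto simp: e_def elim!: oddE evenE)
  \<comment> \<open>Cauchy product with the geometric series: since r^i * r^(n-i) = r^n, the n-th
    term is r^n times a partial sum of e.\<close>
  have "(\<lambda>n. \<Sum>i\<le>n. (e i * r ^ i) * r ^ (n - i)) sums ((\<Sum>i. e i * r ^ i) * (\<Sum>i. r ^ i))"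
    using r e geo by (intro Cauchy_product_sums) (auto simp: sums_iff e_def abs_mult)
  also have "(\<lambda>n. \<Sum>i\<le>n. (e i * r ^ i) * r ^ (n - i)) = (\<lambda>n. (\<Sum>k<Suc n div 2. (b k)\<^sup>2) * r ^ n)"
    by (auto simp: fun_eq_iff e_sum[symmetric] sum_distrib_right mult.assoc power_add[symmetric] intro!: sum.cong)
  also have "(\<Sum>i. e i * r ^ i) * (\<Sum>i. r ^ i) = r * N * (1 / (1 - r))"
    using e r by (simp add: sums_iff suminf_geometric)
  finally have "(\<lambda>n. r ^ n - (\<Sum>k<Suc n div 2. (b k)\<^sup>2) * r ^ n) sums (1 / (1 - r) - r * N * (1 / (1 - r)))"
    using r by (intro sums_diff geometric_sums) auto
  moreover have "b n * r ^ n \<le> r ^ n - (\<Sum>k<Suc n div 2. (b k)\<^sup>2) * r ^ n" for n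
    using mult_right_mono[OF Carlson[of "Suc n div 2" n], of "r ^ n"] r by (simp add: algebra_simps)
  ultimately have "(\<Sum>n. b n * r ^ n) \<le> 1 / (1 - r) - r * N * (1 / (1 - r))"
    by (intro sums_le[OF _ summable_sums[OF sb]])
  then show "(\<Sum>n. b n * r ^ n) \<le> 1 / (1 - r) * (1 - r * (\<Sum>n. (b n)\<^sup>2 * r ^ (2 * n)))"
    by (simp add: N_def right_diff_distrib)
qed

section \<open>Transfer to the class of bounded functions\<close>

lemma power_series_on_disk_has_fps_expansion:
  assumes "power_series_on_disk a f"
  shows "f has_fps_expansion Abs_fps a"
proof (rule has_fps_expansionI)
  have "eventually (\<lambda>u. u \<in> ball 0 1) (nhds (0::complex))"
    by (intro eventually_nhds_in_open) auto
  then show "eventually (\<lambda>u. (\<lambda>n. fps_nth (Abs_fps a) n * u ^ n) sums f u) (nhds 0)"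
    by eventually_elim (use assms in \<open>auto simp: power_series_on_disk_def unit_disk_def\<close>)
qed

text \<open>Uniqueness of Taylor coefficients; it turns \<open>disk_norm_sq f r\<close> into a
  series in the given coefficients.\<close>

lemma power_series_on_disk_fps_expansion:
  assumes "power_series_on_disk a f"
  shows "fps_nth (fps_expansion f 0) n = a n"
  using fps_nth_fps_expansion[OF power_series_on_disk_has_fps_expansion[OF assms], of n]
  by (simp add: fps_expansion_def)

theorem theorem1:
  shows "(\<forall>f\<in>class_B. \<forall>a. power_series_on_disk a f \<longrightarrow>
            (\<forall>r\<in>{0..<1::real}.
               summable (\<lambda>n. cmod (a n) * r ^ n) \<and>
               summable (\<lambda>n. (cmod (a n))\<^sup>2 * r ^ (2 * n)) \<and>
               (\<Sum>n. cmod (a n) * r ^ n) \<le> 1 / (1 - r) * (1 - r * disk_norm_sq f r)))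
       \<and> (\<lambda>z. 1) \<in> class_B
       \<and> (\<exists>a. power_series_on_disk a (\<lambda>z. 1) \<and>
            (\<forall>r\<in>{0..<1::real}.
               (\<Sum>n. cmod (a n) * r ^ n) = 1 / (1 - r) * (1 - r * disk_norm_sq (\<lambda>z. 1) r)))"
proof (intro conjI ballI allI impI)
  fix f a and r :: real
  assume f: "f \<in> class_B" and a: "power_series_on_disk a f" and r: "r \<in> {0..<1}"
  have disk: "unit_disk = ball 0 1"
    by (auto simp: unit_disk_def)
  have "f holomorphic_on ball 0 1" "\<And>z. z \<in> ball 0 1 \<Longrightarrow> cmod (f z) \<le> 1"
    using f by (auto simp: class_B_def disk intro: analytic_imp_holomorphic)
  then have Carlson: "cmod (a n) + (\<Sum>k<m. (cmod (a k))\<^sup>2) \<le> 1" if "2 * m \<le> Suc n" for m n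
    using Carlson_coeff_bound[OF _ power_series_on_disk_has_fps_expansion[OF a] _ that] by simp
  have r': "0 \<le> r" "r < 1"
    using r by auto
  note * = suminf_bound_of_Carlson[OF norm_ge_zero r' Carlson]
  show "summable (\<lambda>n. cmod (a n) * r ^ n)" "summable (\<lambda>n. (cmod (a n))\<^sup>2 * r ^ (2 * n))"
    by (rule *; assumption)+
  show "(\<Sum>n. cmod (a n) * r ^ n) \<le> 1 / (1 - r) * (1 - r * disk_norm_sq f r)"
    unfolding disk_norm_sq_def power_series_on_disk_fps_expansion[OF a] by (rule *(3))
next
  show "(\<lambda>z. 1) \<in> class_B"
    by (simp add: class_B_def)
next
  define a :: "nat \<Rightarrow> complex" where "a n = (if n = 0 then 1 else 0)" for n
  have a: "power_series_on_disk a (\<lambda>z. 1)"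
    using sums_single[of 0 "\<lambda>_. 1 :: complex"]
    by (auto simp: power_series_on_disk_def a_def if_distrib if_distribR cong: if_cong)
  \<comment> \<open>Only n = 0 contributes, with r^0 = 1 also for r = 0. The claimed equality then
    reads 1 = (1 - r) / (1 - r).\<close>
  have "(\<Sum>n. cmod (a n) * r ^ n) = 1" "(\<Sum>n. (cmod (a n))\<^sup>2 * r ^ (2 * n)) = 1" for r :: real
    by (subst suminf_finite[of "{0}"]; simp add: a_def)+
  then show "\<exists>a. power_series_on_disk a (\<lambda>z. 1) \<and>
            (\<forall>r\<in>{0..<1::real}.
               (\<Sum>n. cmod (a n) * r ^ n) = 1 / (1 - r) * (1 - r * disk_norm_sq (\<lambda>z. 1) r))"
    unfolding disk_norm_sq_def using a by (intro exI[of _ a]) (simp add: power_series_on_disk_fps_expansion)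
qed

end
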